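(* For every odd integer $k\ge 3$, $\mathcal{D}_k\setminus\mathcal{D}_{k-2}\neq\emptyset$.
   Context: A tournament is a directed graph with exactly one arc between each pair of distinct vertices. For a tournament $T$ on vertices $v_1,\dots,v_n$, its skew-adjacency matrix is the zero-diagonal matrix $S_T=[s_{ij}]$ with $s_{ij}=-s_{ji}=1$ if there is an arc from $v_i$ to $v_j$, and $\det(T):=\det(S_T)$. A subtournament of $T$ is the tournament induced by a nonempty vertex subset (including $T$ itself). For a positive odd integer $k$, $\mathcal{D}_k$ is the set of tournaments all of whose subtournaments have determinant at most $k^2$. *)

theory Defs
  imports "Graph_Theory.Digraph_Component" "Jordan_Normal_Form.Determinant"
begin

definition tournament :: "('a, 'b) pre_digraph \<Rightarrow> bool" where
  "tournament T \<longleftrightarrow> digraph T \<and> verts T \<noteq> {} \<and>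
     (\<forall>u \<in> verts T. \<forall>v \<in> verts T. u \<noteq> v \<longrightarrow>
        (\<exists>!e. e \<in> arcs T \<and> {tail T e, head T e} = {u, v}))"

text \<open>The list fixes the enumeration \<open>v\<^sub>1, \<dots>, v\<^sub>n\<close> of the vertices.\<close>

definition skew_adjacency_matrix :: "('a, 'b) pre_digraph \<Rightarrow> 'a list \<Rightarrow> int mat" where
  "skew_adjacency_matrix T vs = mat (length vs) (length vs) (\<lambda>(i, j).
     if vs ! i \<rightarrow>\<^bsub>T\<^esub> vs ! j then 1
     else if vs ! j \<rightarrow>\<^bsub>T\<^esub> vs ! i then -1 else 0)"

text \<open>The increasing enumeration is only a canonical choice:
  see \<open>tournament_det_eq\<close> below.\<close>

definition tournament_det :: "('a :: linorder, 'b) pre_digraph \<Rightarrow> int" where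
  "tournament_det T = det (skew_adjacency_matrix T (sorted_list_of_set (verts T)))"

definition subtournaments :: "('a, 'b) pre_digraph \<Rightarrow> ('a, 'b) pre_digraph set" where
  "subtournaments T = {T \<restriction> X | X. X \<noteq> {} \<and> X \<subseteq> verts T}"

definition tournaments_det_le :: "int \<Rightarrow> ('a :: linorder, 'b) pre_digraph set" (\<open>\<D>\<close>) where
  "\<D> k = {T. tournament T \<and> (\<forall>H \<in> subtournaments T. tournament_det H \<le> k\<^sup>2)}"

lemma det_permute_rows_cols:
  fixes A :: "'a :: comm_ring_1 mat"
  assumes A: "A \<in> carrier_mat n n" and p: "p permutes {0..<n}"
  shows "det (mat n n (\<lambda>(i, j). A $$ (p i, p j))) = det A"
proof -
  define B where "B = mat n n (\<lambda>(i, j). A $$ (p i, j))"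
  have B: "B \<in> carrier_mat n n" by (simp add: B_def)
  have lt: "p i < n" if "i < n" for i
    using permutes_in_image[OF p, of i] that by simp
  have "mat n n (\<lambda>(i, j). A $$ (p i, p j))
      = transpose_mat (mat n n (\<lambda>(i, j). transpose_mat B $$ (p i, j)))"
    using lt by (auto simp: B_def)
  also have "det \<dots> = det (mat n n (\<lambda>(i, j). transpose_mat B $$ (p i, j)))"
    by (rule det_transpose[of _ n]) simp
  also have "\<dots> = signof p * det (transpose_mat B)"
    using B by (intro det_permute_rows p) simp
  also have "\<dots> = signof p * (signof p * det A)"
    using det_transpose[OF B] det_permute_rows[OF A p] by (simp add: B_def)
  also have "\<dots> = det A"
    by (simp add: sign_def)
  finally show ?thesis .
qed

lemma tournament_det_eq:
  assumes "distinct vs" and "set vs = verts T"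
  shows "det (skew_adjacency_matrix T vs) = tournament_det T"
proof -
  let ?ws = "sorted_list_of_set (verts T)"
  have "finite (verts T)" using assms(2) by (metis finite_set)
  hence "mset vs = mset ?ws"
    using assms by (metis distinct_sorted_list_of_set set_eq_iff_mset_eq_distinct
      set_sorted_list_of_set)
  then obtain p where p: "p permutes {..<length ?ws}" and vs: "permute_list p ?ws = vs"
    by (rule mset_eq_permutation)
  let ?n = "length ?ws"
  have p': "p permutes {0..<?n}" using p by (simp add: atLeast0LessThan)
  have lt: "p i < ?n" if "i < ?n" for i
    using permutes_in_image[OF p, of i] that by simp
  have len: "length vs = ?n" using vs by auto
  have nth: "vs ! i = ?ws ! p i" if "i < ?n" for i
    using permute_list_nth[OF p that] vs by simp
  have "skew_adjacency_matrix T vs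
      = mat ?n ?n (\<lambda>(i, j). skew_adjacency_matrix T ?ws $$ (p i, p j))"
    by (rule eq_matI) (simp_all add: skew_adjacency_matrix_def len nth lt del: length_sorted_list_of_set)
  thus ?thesis
    unfolding tournament_det_def
    using det_permute_rows_cols[OF _ p', of "skew_adjacency_matrix T ?ws"]
    by (simp add: skew_adjacency_matrix_def del: length_sorted_list_of_set)
qed

end

theory Submission
  imports Defs
begin

text \<open>Take the transitive tournament on \<open>0 < \<dots> < k - 1\<close> and add one vertex \<open>k\<close> whose arcs
  alternate in direction. For odd \<open>m\<close> the skew-adjacency matrix of the transitive tournament on
  \<open>m\<close> vertices annihilates the alternating vector, so bordering it by a vector \<open>x\<close> gives
  determinant \<open>(\<Sum>i<m. (-1) ^ i * x i)\<^sup>2\<close>. For \<open>x\<close> with entries \<open>\<plusminus>1\<close> this is at most \<open>m\<^sup>2\<close>,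
  with equality for alternating \<open>x\<close>.\<close>

section \<open>Determinants of transitive and bordered matrices\<close>

definition transitive_mat :: "nat \<Rightarrow> int mat" where
  "transitive_mat m = mat m m (\<lambda>(i, j). sgn (int j - int i))"

text \<open>Adds a last vertex: \<open>x i = 1\<close> encodes an arc from \<open>i\<close> to it,
  \<open>x i = -1\<close> the reverse arc. A free \<open>x\<close> covers the next transitive matrix
  as well as every subtournament containing the extra vertex.\<close>

definition bordered_transitive_mat :: "nat \<Rightarrow> (nat \<Rightarrow> int) \<Rightarrow> int mat" where
  "bordered_transitive_mat m x = mat (Suc m) (Suc m) (\<lambda>(i, j).
     if i < m \<and> j < m then sgn (int j - int i)
     else if i < m then x i else if j < m then - x j else 0)"

lemma det_skew_odd:
  fixes A :: "int mat"
  assumes A: "A \<in> carrier_mat n n" and "odd n" and skew: "transpose_mat A = (-1) \<cdot>\<^sub>m A"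
  shows "det A = 0"
proof -
  have "det A = det ((-1) \<cdot>\<^sub>m A)"
    using det_transpose[OF A] skew by simp
  also have "\<dots> = - det A"
    using A \<open>odd n\<close> by simp
  finally show ?thesis by simp
qed

text \<open>The sign factor is -1 until \<open>k\<close> reaches \<open>i\<close>, 0 there and 1
  afterwards; the skipped term swaps the parity at which the partial sums vanish. Odd
  \<open>m\<close> with \<open>i < m\<close> is the kernel relation.\<close>

lemma sum_sgn_alternating:
  "(\<Sum>k<m. sgn (int k - int i) * (-1) ^ k)
     = (if i < m then (if odd m then 0 else -1) else (if odd m then -1 else 0) :: int)"
  by (induction m) (auto simp: less_Suc_eq not_less)

text \<open>A congruence puts the alternating combination of the first \<open>m\<close> rows and
  columns into row and column 0, where the kernel relation leaves only \<open>s\<close> and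
  \<open>- s\<close> at the border. Expanding along both leaves the indices strictly between
  \<open>0\<close> and \<open>m\<close>.\<close>

lemma det_bordered_transitive_mat_odd:
  assumes "odd m"
  shows "det (bordered_transitive_mat m x)
    = (\<Sum>i<m. (-1) ^ i * x i)\<^sup>2 * det (transitive_mat (m - 1))"
proof -
  define s where "s = (\<Sum>i<m. (-1) ^ i * x i)"
  define A where "A = bordered_transitive_mat m x"
  \<comment> \<open>The identity with row 0 replaced by the alternating vector, padded by 0 at the
    border index \<open>m\<close>; the corner entry is 1 because \<open>0 < m\<close>.\<close>
  define P :: "int mat" where "P = mat (Suc m) (Suc m) (\<lambda>(i, j).
    if i = 0 then (if j < m then (-1) ^ j else 0) else if i = j then 1 else 0)"
  define C where "C = A * transpose_mat P"
  define B where "B = P * C"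
  have m0: "0 < m" using \<open>odd m\<close> by (cases m) auto
  have A: "A \<in> carrier_mat (Suc m) (Suc m)"
    by (simp add: A_def bordered_transitive_mat_def)
  have P: "P \<in> carrier_mat (Suc m) (Suc m)"
    by (simp add: P_def)
  have C: "C \<in> carrier_mat (Suc m) (Suc m)"
    unfolding C_def using A P by (intro mult_carrier_mat[of _ _ "Suc m"]) simp_all
  have B: "B \<in> carrier_mat (Suc m) (Suc m)"
    unfolding B_def using P C by (rule mult_carrier_mat)
  note carr = A P C B
  have "det P = prod_list (diag_mat P)"
    by (rule det_upper_triangular[OF _ carr(2)]) (auto simp: upper_triangular_def P_def)
  also have "\<dots> = 1"
    unfolding prod_list_diag_prod using m0 by (intro prod.neutral) (auto simp: P_def)
  finally have detP: "det P = 1" .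
  have detB: "det B = det A"
    using carr detP by (simp add: B_def C_def det_mult[of _ "Suc m"] det_transpose)
  have C_nth: "C $$ (i, j) = (\<Sum>k<Suc m. A $$ (i, k) * P $$ (j, k))"
    if "i < Suc m" "j < Suc m" for i j
    using that carr by (simp add: C_def scalar_prod_def atLeast0LessThan del: sum.lessThan_Suc)
  have B_nth: "B $$ (i, j) = (\<Sum>k<Suc m. P $$ (i, k) * C $$ (k, j))"
    if "i < Suc m" "j < Suc m" for i j
    using that carr by (simp add: B_def scalar_prod_def atLeast0LessThan del: sum.lessThan_Suc)
  have C_pos: "C $$ (i, j) = A $$ (i, j)" if "i < Suc m" "0 < j" "j < Suc m" for i j
  proof -
    have "C $$ (i, j) = (\<Sum>k<Suc m. if k = j then A $$ (i, k) else 0)"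
      unfolding C_nth[OF that(1,3)] using that by (intro sum.cong) (auto simp: P_def)
    thus ?thesis using that by simp
  qed
  have C_0: "C $$ (i, 0) = (if i < m then 0 else - s)" if "i < Suc m" for i
  proof -
    have "C $$ (i, 0) = (\<Sum>k<m. A $$ (i, k) * (-1) ^ k)"
      using that m0 by (simp add: C_nth P_def)
    also have "\<dots> = (if i < m then 0 else - s)"
      using that sum_sgn_alternating[of i m] \<open>odd m\<close>
      by (auto simp: A_def bordered_transitive_mat_def s_def sum_negf[symmetric] mult.commute
          intro!: sum.cong)
    finally show ?thesis .
  qed
  have B_pos: "B $$ (i, j) = C $$ (i, j)" if "0 < i" "i < Suc m" "j < Suc m" for i j
  proof -
    have "B $$ (i, j) = (\<Sum>k<Suc m. if k = i then C $$ (k, j) else 0)"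
      unfolding B_nth[OF that(2,3)] using that by (intro sum.cong) (auto simp: P_def)
    thus ?thesis using that by simp
  qed
  have B_0: "B $$ (0, j) = (if j < m then 0 else s)" if "j < Suc m" for j
  proof -
    have B0: "B $$ (0, j) = (\<Sum>k<m. (-1) ^ k * C $$ (k, j))"
      using that m0 by (simp add: B_nth P_def)
    consider "j = 0" | "0 < j" "j < m" | "j = m" using \<open>j < Suc m\<close> by linarith
    thus ?thesis
    proof cases
      case 1
      thus ?thesis using B0 m0 by (simp add: C_0)
    next
      case 2
      have "B $$ (0, j) = (\<Sum>k<m. - (sgn (int k - int j) * (-1) ^ k))"
        unfolding B0 using 2
        by (intro sum.cong) (auto simp: C_pos A_def bordered_transitive_mat_def sgn_if)
      also have "\<dots> = 0"
        using 2 \<open>odd m\<close> by (simp add: sum_negf sum_sgn_alternating)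
      finally show ?thesis using 2 by simp
    next
      case 3
      thus ?thesis using B0 m0
        by (simp add: C_pos A_def bordered_transitive_mat_def s_def)
    qed
  qed
  define D where "D = mat_delete B 0 m"
  have D: "D \<in> carrier_mat m m"
    using mat_delete_carrier[OF carr(4)] by (simp add: D_def)
  have "det B = (\<Sum>j<Suc m. B $$ (0, j) * cofactor B 0 j)"
    by (rule laplace_expansion_row[OF carr(4)]) simp
  also have "\<dots> = s * cofactor B 0 m"
    by (simp add: B_0)
  also have "\<dots> = - s * det D"
    using \<open>odd m\<close> by (simp add: cofactor_def D_def)
  finally have detB_D: "det B = - s * det D" .
  \<comment> \<open>Deleting row 0 moves the border row to index \<open>m - 1\<close>, the only
    place where column 0 can be nonzero. Its cofactor sign is 1, against -1 in the first expansion,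
    so two factors \<open>- s\<close> give the square.\<close>
  have D_0: "D $$ (i, 0) = (if i < m - 1 then 0 else - s)" if "i < m" for i
    using that m0 carr by (auto simp: D_def mat_delete_def B_pos C_0)
  have "det D = (\<Sum>i<m. D $$ (i, 0) * cofactor D i 0)"
    by (rule laplace_expansion_column[OF D m0])
  also have "{..<m} = insert (m - 1) {..<m - 1}" using m0 by auto
  also have "(\<Sum>i\<in>\<dots>. D $$ (i, 0) * cofactor D i 0) = - s * cofactor D (m - 1) 0"
    using m0 by (simp add: D_0)
  also have "\<dots> = - s * det (mat_delete D (m - 1) 0)"
    using \<open>odd m\<close> by (simp add: cofactor_def)
  also have "mat_delete D (m - 1) 0 = transitive_mat (m - 1)"
    using carr m0 by (intro eq_matI)
      (auto simp: D_def mat_delete_def transitive_mat_def B_pos C_pos A_def bordered_transitive_mat_def)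
  finally show ?thesis
    using detB_D detB by (simp add: A_def s_def power2_eq_square)
qed

text \<open>The last vertex is a sink, so its border is constantly 1; this makes the bordered
  formula a recursion.\<close>

lemma transitive_mat_Suc: "transitive_mat (Suc m) = bordered_transitive_mat m (\<lambda>_. 1)"
  by (rule eq_matI) (auto simp: transitive_mat_def bordered_transitive_mat_def less_Suc_eq)

lemma det_transitive_mat_even: "det (transitive_mat (2 * n)) = 1"
proof (induction n)
  case 0
  show ?case by (simp add: transitive_mat_def)
next
  case (Suc n)
  \<comment> \<open>The border consists of \<open>Suc (2 * n)\<close> ones, whose alternating sum is
    this 0 plus a final 1.\<close>
  have "(\<Sum>i<2 * n. (-1) ^ i) = (0 :: int)" by (induction n) simp_all
  thus ?case using Suc
    by (simp add: transitive_mat_Suc[of "Suc (2 * n)"] det_bordered_transitive_mat_odd)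
qed

text \<open>For odd \<open>m\<close> the remaining factor has even size \<open>m - 1\<close>, hence
  determinant 1; for even \<open>m\<close> the matrix is skew of odd size.\<close>

lemma det_bordered_transitive_mat:
  "det (bordered_transitive_mat m x) = (if odd m then (\<Sum>i<m. (-1) ^ i * x i)\<^sup>2 else 0)"
proof (cases "odd m")
  case True
  then obtain n where "m = 2 * n + 1" by (rule oddE)
  thus ?thesis
    using det_bordered_transitive_mat_odd[OF True] det_transitive_mat_even[of n] by simp
next
  case False
  have "det (bordered_transitive_mat m x) = 0"
  proof (rule det_skew_odd[of _ "Suc m"])
    show "transpose_mat (bordered_transitive_mat m x) = (-1) \<cdot>\<^sub>m bordered_transitive_mat m x"
      by (rule eq_matI) (auto simp: bordered_transitive_mat_def sgn_if)
  qed (use False in \<open>simp_all add: bordered_transitive_mat_def\<close>)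
  thus ?thesis using False by simp
qed

lemma det_transitive_mat_le_1: "det (transitive_mat m) \<le> 1"
proof (cases "even m")
  case True
  thus ?thesis using det_transitive_mat_even by (auto elim!: evenE)
next
  case False
  then obtain n where "m = Suc (2 * n)" by (auto elim!: oddE)
  thus ?thesis by (simp add: transitive_mat_Suc det_bordered_transitive_mat)
qed

section \<open>The alternating tournament\<close>

definition alternating_tournament :: "nat \<Rightarrow> (nat, nat \<times> nat) pre_digraph" where
  "alternating_tournament n = \<lparr>verts = {..n},
     arcs = {(i, j). i < j \<and> j < n} \<union> {(i, j). i < n \<and> j = n \<and> even i}
       \<union> {(i, j). j < n \<and> i = n \<and> odd j},
     tail = fst, head = snd\<rparr>"

lemma tournament_alternating_tournament: "tournament (alternating_tournament n)"
proof -
  let ?T = "alternating_tournament n"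
  have "arcs ?T \<subseteq> {..n} \<times> {..n}"
    by (auto simp: alternating_tournament_def)
  hence "finite (arcs ?T)"
    by (rule finite_subset) simp
  hence "digraph ?T"
    by unfold_locales (auto simp: alternating_tournament_def arc_to_ends_def)
  moreover have "\<exists>!e. e \<in> arcs ?T \<and> {tail ?T e, head ?T e} = {u, v}"
    if "u \<in> verts ?T" "v \<in> verts ?T" "u \<noteq> v" for u v
  proof (cases "(u, v) \<in> arcs ?T")
    case True
    thus ?thesis using that
      by (intro ex1I[of _ "(u, v)"]) (auto simp: alternating_tournament_def doubleton_eq_iff)
  next
    case False
    hence "(v, u) \<in> arcs ?T"
      using that by (auto simp: alternating_tournament_def)
    thus ?thesis using that
      by (intro ex1I[of _ "(v, u)"]) (auto simp: alternating_tournament_def doubleton_eq_iff)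
  qed
  ultimately show ?thesis
    by (auto simp: tournament_def alternating_tournament_def)
qed

lemma dominates_alternating_subtournament:
  "u \<rightarrow>\<^bsub>alternating_tournament n \<restriction> X\<^esub> v \<longleftrightarrow> u \<in> X \<and> v \<in> X \<and>
     (u < v \<and> v < n \<or> u < n \<and> v = n \<and> even u \<or> v < n \<and> u = n \<and> odd v)"
  by (auto simp: alternating_tournament_def induce_subgraph_def arcs_ends_def arc_to_ends_def
      image_iff)

section \<open>Determinants of its subtournaments\<close>

lemma sorted_list_of_set_nth_less_iff:
  fixes X :: "'a :: linorder set"
  assumes "i < card X" "j < card X"
  shows "sorted_list_of_set X ! i < sorted_list_of_set X ! j \<longleftrightarrow> i < j"
  using assms strict_sorted_list_of_set[of X]
  by (metis length_sorted_list_of_set linorder_neqE_nat order_less_asym' sorted_wrt_nth_less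
      less_irrefl)

text \<open>Arcs among vertices below \<open>n\<close> go upwards, so in increasing order only the
  cardinality of \<open>X\<close> matters.\<close>

lemma det_transitive_subtournament:
  assumes "X \<subseteq> {..<n}"
  shows "tournament_det (alternating_tournament n \<restriction> X) = det (transitive_mat (card X))"
proof -
  have fin: "finite X" using assms by (rule finite_subset) simp
  have mem: "sorted_list_of_set X ! i \<in> X" if "i < card X" for i
    using that fin by (metis length_sorted_list_of_set nth_mem set_sorted_list_of_set)
  have lt: "sorted_list_of_set X ! i < n" if "i < card X" for i
    using mem[OF that] assms by auto
  have "skew_adjacency_matrix (alternating_tournament n \<restriction> X) (sorted_list_of_set X)
      = transitive_mat (card X)"
  proof (rule eq_matI)
    fix i j assume "i < dim_row (transitive_mat (card X))" "j < dim_col (transitive_mat (card X))"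
    hence ij: "i < card X" "j < card X" by (simp_all add: transitive_mat_def)
    show "skew_adjacency_matrix (alternating_tournament n \<restriction> X) (sorted_list_of_set X) $$ (i, j)
        = transitive_mat (card X) $$ (i, j)"
      using ij mem[of i] mem[of j] lt[of i] lt[of j]
        sorted_list_of_set_nth_less_iff[of i X j] sorted_list_of_set_nth_less_iff[of j X i]
      by (auto simp: skew_adjacency_matrix_def transitive_mat_def
          dominates_alternating_subtournament sgn_if)
  qed (simp_all add: skew_adjacency_matrix_def transitive_mat_def)
  thus ?thesis by (simp add: tournament_det_def)
qed

text \<open>Even vertices point to \<open>n\<close> and odd ones receive an arc from it. The
  exponent in the border is the vertex itself, not its position in the list.\<close>

lemma det_bordered_subtournament:
  assumes "X \<subseteq> {..<n}"
  shows "tournament_det (alternating_tournament n \<restriction> insert n X)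
    = det (bordered_transitive_mat (card X) (\<lambda>i. (-1) ^ (sorted_list_of_set X ! i)))"
proof -
  let ?T = "alternating_tournament n \<restriction> insert n X"
  let ?vs = "sorted_list_of_set X"
  let ?B = "bordered_transitive_mat (card X) (\<lambda>i. (-1) ^ (?vs ! i))"
  have fin: "finite X" using assms by (rule finite_subset) simp
  have mem: "?vs ! i \<in> X" if "i < card X" for i
    using that fin by (metis length_sorted_list_of_set nth_mem set_sorted_list_of_set)
  have lt: "?vs ! i < n" if "i < card X" for i
    using mem[OF that] assms by auto
  have "skew_adjacency_matrix ?T (?vs @ [n]) = ?B"
  proof (rule eq_matI)
    fix i j assume "i < dim_row ?B" "j < dim_col ?B"
    hence ij: "i \<le> card X" "j \<le> card X" by (simp_all add: bordered_transitive_mat_def)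
    show "skew_adjacency_matrix ?T (?vs @ [n]) $$ (i, j) = ?B $$ (i, j)"
    proof (cases "i < card X \<and> j < card X")
      case True
      thus ?thesis
        using mem[of i] mem[of j] lt[of i] lt[of j]
          sorted_list_of_set_nth_less_iff[of i X j] sorted_list_of_set_nth_less_iff[of j X i]
        by (auto simp: skew_adjacency_matrix_def bordered_transitive_mat_def nth_append
            dominates_alternating_subtournament sgn_if)
    next
      case False
      thus ?thesis
        using ij mem[of i] mem[of j] lt[of i] lt[of j]
        by (auto simp: skew_adjacency_matrix_def bordered_transitive_mat_def nth_append
            dominates_alternating_subtournament)
    qed
  qed (simp_all add: skew_adjacency_matrix_def bordered_transitive_mat_def)
  \<comment> \<open>Any enumeration gives the same determinant, so \<open>n\<close> may simply be
    appended.\<close>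
  moreover have "det (skew_adjacency_matrix ?T (?vs @ [n])) = tournament_det ?T"
    using assms fin by (intro tournament_det_eq) auto
  ultimately show ?thesis by simp
qed

section \<open>The upper bound and its attainment\<close>

lemma alternating_sum_squared_le:
  fixes x :: "nat \<Rightarrow> int"
  assumes "\<And>i. \<bar>x i\<bar> = 1"
  shows "(\<Sum>i<m. (-1) ^ i * x i)\<^sup>2 \<le> (int m)\<^sup>2"
proof -
  have "\<bar>\<Sum>i<m. (-1) ^ i * x i\<bar> \<le> (\<Sum>i<m. \<bar>(-1) ^ i * x i\<bar>)"
    by (rule sum_abs)
  also have "\<dots> = int m"
    by (simp add: abs_mult power_abs assms)
  finally show ?thesis
    by (intro abs_le_square_iff[THEN iffD1]) simp
qed

text \<open>With \<open>n\<close> in \<open>X\<close>, the determinant is 0 or the square of a sum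
  of at most \<open>n\<close> signs; otherwise the transitive bound 1 applies.\<close>

lemma alternating_subtournament_det_le:
  assumes "X \<subseteq> {..n}" and "1 \<le> n"
  shows "tournament_det (alternating_tournament n \<restriction> X) \<le> (int n)\<^sup>2"
proof (cases "n \<in> X")
  case True
  define Y where "Y = X - {n}"
  have Y: "Y \<subseteq> {..<n}" and X: "X = insert n Y"
    using assms True by (auto simp: Y_def less_le)
  have "tournament_det (alternating_tournament n \<restriction> X) \<le> (int (card Y))\<^sup>2"
    unfolding X det_bordered_subtournament[OF Y] det_bordered_transitive_mat
    using alternating_sum_squared_le[of "\<lambda>i. (-1) ^ (sorted_list_of_set Y ! i)" "card Y"]
    by (simp add: power_abs)
  also have "\<dots> \<le> (int n)\<^sup>2"
    using card_mono[OF _ Y] by (intro power_mono) simp_all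
  finally show ?thesis .
next
  case False
  hence "X \<subseteq> {..<n}" using assms by (auto simp: less_le)
  hence "tournament_det (alternating_tournament n \<restriction> X) \<le> 1"
    using det_transitive_subtournament det_transitive_mat_le_1 by metis
  also have "\<dots> \<le> (int n)\<^sup>2" using assms by (simp add: one_le_power)
  finally show ?thesis .
qed

text \<open>On the full vertex set position and vertex coincide, so the border signs cancel the
  alternating ones and all \<open>n\<close> terms are 1.\<close>

lemma det_alternating_tournament:
  assumes "odd n"
  shows "tournament_det (alternating_tournament n \<restriction> {..n}) = (int n)\<^sup>2"
proof -
  have vs: "sorted_list_of_set {..<n} = [0..<n]"
    by (simp add: atLeast0LessThan[symmetric])
  have "tournament_det (alternating_tournament n \<restriction> insert n {..<n})
      = (\<Sum>i<n. (-1) ^ i * (-1) ^ ([0..<n] ! i))\<^sup>2"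
    using assms by (simp add: det_bordered_subtournament det_bordered_transitive_mat vs)
  also have "(\<Sum>i<n. (-1) ^ i * (-1) ^ ([0..<n] ! i)) = (\<Sum>i<n. 1 :: int)"
    by (intro sum.cong) (simp_all flip: power_mult_distrib)
  finally show ?thesis by (simp add: atMost_Suc lessThan_Suc_atMost[symmetric] lessThan_Suc)
qed

theorem theorem4p8:
  fixes k :: int
  assumes "odd k" and "k \<ge> 3"
  shows "(\<D> k - \<D> (k - 2) :: (nat, nat \<times> nat) pre_digraph set) \<noteq> {}"
proof -
  define n where "n = nat k"
  have k: "k = int n" using assms by (simp add: n_def)
  have n: "odd n" "3 \<le> n" using assms by (simp_all add: k)
  let ?T = "alternating_tournament n"
  have verts: "verts ?T = {..n}" by (simp add: alternating_tournament_def)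
  have "?T \<in> \<D> k"
    using n tournament_alternating_tournament alternating_subtournament_det_le
    by (auto simp: tournaments_det_le_def subtournaments_def verts k)
  moreover have "?T \<restriction> {..n} \<in> subtournaments ?T"
    by (auto simp: subtournaments_def verts)
  \<comment> \<open>Squaring is strictly monotone here because \<open>k \<ge> 3\<close> makes
    \<open>k - 2\<close> nonnegative; the whole tournament thus violates the smaller bound.\<close>
  moreover have "(k - 2)\<^sup>2 < tournament_det (?T \<restriction> {..n})"
    unfolding det_alternating_tournament[OF n(1)] k[symmetric]
    using assms by (intro power_strict_mono) simp_all
  ultimately show ?thesis
    by (force simp: tournaments_det_le_def)
qed

end
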